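(* Let $n\geq5$ be odd, let $G=\mathrm{Sym}(n)$ (acting on $\{1,\dots,n\}$), let $m:=(n-1)/2$, let $H=\langle (i,i+m)\mid i=1,\dots,m\rangle$, and let $g=(1,2,3,\dots,n)$. Let $\Gamma=\mathrm{Cos}(G,H,g)$. Then $(\Gamma,G)\in\mathcal{OG}(4)$ is basic of quasiprimitive type, and a vertex stabiliser $G_x$ has order $2^{(n-1)/2}$.
   Context: All graphs are finite, simple and undirected. For a group $G$, a proper subgroup $H$ and an element $s\in G$, the coset graph $\mathrm{Cos}(G,H,s)$ is the undirected graph with vertex set $\{Hx\mid x\in G\}$ and with $\{Hx,Hy\}$ an edge if and only if $xy^{-1}\in HsH$ or $yx^{-1}\in HsH$; $G$ acts on it by right multiplication. Permutations act on the right (products are read left to right). $\mathcal{OG}(4)$ is the set of pairs $(\Gamma,G)$ where $\Gamma$ is a connected graph of valency $4$ with vertex set $X$, and $G\leq\mathrm{Aut}(\Gamma)$ is transitive on $X$ and on edges, and $\Gamma$ is $G$-oriented: there is a $G$-orbit $\Delta\subset X\times X$, disjoint from $\Delta^*=\{(y,x)\mid (x,y)\in\Delta\}$, such that the edges of $\Gamma$ are exactly the pairs $\{x,y\}$ with $(x,y)\in\Delta$ or $(y,x)\in\Delta$. (For the coset graph, $G\leq\mathrm{Aut}(\Gamma)$ means that the right multiplication action of $G$ is faithful.) A pair $(\Gamma,G)\in\mathcal{OG}(4)$ is basic of quasiprimitive type if $G$ is quasiprimitive on $X$, that is, every nontrivial normal subgroup of $G$ is transitive on $X$. *)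

theory Defs
  imports
    "HOL-Algebra.Sym_Groups"
    "HOL-Algebra.Group_Action"
    "HOL-Combinatorics.Cycles"
    "Graph_Theory.Graph_Theory"
begin

text \<open>
  Permutations act on the right, so products are read left to right: the symmetric group meant
  here is the opposite of the library's \<open>sym_group n\<close>, whose product is function composition.
\<close>

definition opposite_group :: "('a, 'b) monoid_scheme \<Rightarrow> ('a, 'b) monoid_scheme" where
  "opposite_group G = G\<lparr>mult := \<lambda>x y. y \<otimes>\<^bsub>G\<^esub> x\<rparr>"

definition Sym :: "nat \<Rightarrow> (nat \<Rightarrow> nat) monoid" where
  "Sym n = opposite_group (sym_group n)"

text \<open>
  The library's action locales describe left actions. A right action of \<open>G\<close> on \<open>X\<close>
  is a left action of the opposite group, with \<open>\<phi> g x\<close> standing for \<open>x\<close> acted on by \<open>g\<close>.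
  The library's \<open>orbit\<close> and \<open>stabilizer\<close> do not depend on the product, so they apply to
  right actions as they stand.
\<close>

definition faithful_right_action ::
    "('a, 'b) monoid_scheme \<Rightarrow> 'v set \<Rightarrow> ('a \<Rightarrow> 'v \<Rightarrow> 'v) \<Rightarrow> bool" where
  "faithful_right_action G X \<phi> \<longleftrightarrow> faithful_action (opposite_group G) X \<phi>"

definition transitive_right_action ::
    "('a, 'b) monoid_scheme \<Rightarrow> 'v set \<Rightarrow> ('a \<Rightarrow> 'v \<Rightarrow> 'v) \<Rightarrow> bool" where
  "transitive_right_action G X \<phi> \<longleftrightarrow> transitive_action (opposite_group G) X \<phi>"

definition quasiprimitive ::
    "('a, 'b) monoid_scheme \<Rightarrow> 'v set \<Rightarrow> ('a \<Rightarrow> 'v \<Rightarrow> 'v) \<Rightarrow> bool" where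
  "quasiprimitive G X \<phi> \<longleftrightarrow>
     (\<forall>N. N \<lhd> G \<and> N \<noteq> {\<one>\<^bsub>G\<^esub>} \<longrightarrow> transitive_right_action (G\<lparr>carrier := N\<rparr>) X \<phi>)"

text \<open>
  A finite simple undirected graph is a \<open>pair_graph\<close>: the edge \<open>{x, y}\<close> is represented by the
  two arcs \<open>(x, y)\<close> and \<open>(y, x)\<close>. Hence the valency of a vertex is its out-degree.
\<close>

definition graph_automorphism :: "'v pair_pre_digraph \<Rightarrow> ('v \<Rightarrow> 'v) \<Rightarrow> bool" where
  "graph_automorphism \<Gamma> f \<longleftrightarrow>
     bij_betw f (pverts \<Gamma>) (pverts \<Gamma>) \<and>
     (\<forall>x\<in>pverts \<Gamma>. \<forall>y\<in>pverts \<Gamma>. (x, y) \<in> parcs \<Gamma> \<longleftrightarrow> (f x, f y) \<in> parcs \<Gamma>)"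

definition edge_transitive ::
    "('a, 'b) monoid_scheme \<Rightarrow> 'v pair_pre_digraph \<Rightarrow> ('a \<Rightarrow> 'v \<Rightarrow> 'v) \<Rightarrow> bool" where
  "edge_transitive G \<Gamma> \<phi> \<longleftrightarrow>
     (\<forall>(x, y)\<in>parcs \<Gamma>. \<forall>(u, v)\<in>parcs \<Gamma>. \<exists>g\<in>carrier G. {\<phi> g x, \<phi> g y} = {u, v})"

definition oriented ::
    "('a, 'b) monoid_scheme \<Rightarrow> 'v pair_pre_digraph \<Rightarrow> ('a \<Rightarrow> 'v \<Rightarrow> 'v) \<Rightarrow> bool" where
  "oriented G \<Gamma> \<phi> \<longleftrightarrow>
     (\<exists>\<Delta> \<in> orbits G (pverts \<Gamma> \<times> pverts \<Gamma>) (\<lambda>g. map_prod (\<phi> g) (\<phi> g)).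
        \<Delta> \<inter> \<Delta>\<inverse> = {} \<and> parcs \<Gamma> = \<Delta> \<union> \<Delta>\<inverse>)"

text \<open>
  Membership of \<open>(\<Gamma>, G)\<close> in \<open>OG(4)\<close>. The inclusion of \<open>G\<close> in the automorphism group of \<open>\<Gamma>\<close>
  is given by a faithful right action \<open>\<phi>\<close> of \<open>G\<close> by automorphisms.
\<close>

definition OG4 ::
    "'v pair_pre_digraph \<Rightarrow> ('a, 'b) monoid_scheme \<Rightarrow> ('a \<Rightarrow> 'v \<Rightarrow> 'v) \<Rightarrow> bool" where
  "OG4 \<Gamma> G \<phi> \<longleftrightarrow>
     pair_graph \<Gamma> \<and> connected (with_proj \<Gamma>) \<and>
     (\<forall>x\<in>pverts \<Gamma>. out_degree (with_proj \<Gamma>) x = 4) \<and>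
     group G \<and> faithful_right_action G (pverts \<Gamma>) \<phi> \<and>
     (\<forall>g\<in>carrier G. graph_automorphism \<Gamma> (\<phi> g)) \<and>
     transitive_right_action G (pverts \<Gamma>) \<phi> \<and>
     edge_transitive G \<Gamma> \<phi> \<and> oriented G \<Gamma> \<phi>"

definition basic_quasiprimitive_type ::
    "'v pair_pre_digraph \<Rightarrow> ('a, 'b) monoid_scheme \<Rightarrow> ('a \<Rightarrow> 'v \<Rightarrow> 'v) \<Rightarrow> bool" where
  "basic_quasiprimitive_type \<Gamma> G \<phi> \<longleftrightarrow> OG4 \<Gamma> G \<phi> \<and> quasiprimitive G (pverts \<Gamma>) \<phi>"

definition coset_graph ::
    "('a, 'b) monoid_scheme \<Rightarrow> 'a set \<Rightarrow> 'a \<Rightarrow> 'a set pair_pre_digraph" where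
  "coset_graph G H s =
     (let HsH = (H #>\<^bsub>G\<^esub> s) <#>\<^bsub>G\<^esub> H in
      \<lparr> pverts = rcosets\<^bsub>G\<^esub> H,
        parcs = {(H #>\<^bsub>G\<^esub> x, H #>\<^bsub>G\<^esub> y) | x y. x \<in> carrier G \<and> y \<in> carrier G \<and>
                   (x \<otimes>\<^bsub>G\<^esub> inv\<^bsub>G\<^esub> y \<in> HsH \<or> y \<otimes>\<^bsub>G\<^esub> inv\<^bsub>G\<^esub> x \<in> HsH)} \<rparr>)"

text \<open>
  Right multiplication on the right cosets of \<open>H\<close>; the restriction is needed because elements of
  \<open>BijGroup\<close> are extensional functions.
\<close>

definition right_mult_action :: "('a, 'b) monoid_scheme \<Rightarrow> 'a set \<Rightarrow> 'a \<Rightarrow> 'a set \<Rightarrow> 'a set" where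
  "right_mult_action G H g = (\<lambda>C\<in>rcosets\<^bsub>G\<^esub> H. C #>\<^bsub>G\<^esub> g)"

end

theory Submission
  imports Defs
begin

text \<open>
  A coset graph carries the arc orbit of \<open>(H s, H)\<close>. It orients the graph because
  \<open>s H s\<close> misses \<open>H\<close>, and it gives valency 4 because \<open>H\<close> has index 2 over both
  \<open>H \<inter> s\<inverse> H s\<close> and \<open>H \<inter> s H s\<inverse>\<close>. For \<open>s = g = (1, \<dots>, n)\<close>
  these facts follow by tracking the point \<open>n\<close>, which \<open>H\<close> fixes. The coset graph is connected since
  \<open>(1, m+1)\<close> and \<open>(m, 2m)\<^sup>g = (m+1, n)\<close> yield \<open>(1, n)\<close>, whose conjugates under \<open>g\<close> are
  all adjacent transpositions.

  For \<open>n \<ge> 5\<close>, a nontrivial normal subgroup \<open>N\<close> of \<open>Sym n\<close> has at most two cosets, because all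
  transpositions agree modulo \<open>N\<close>. As \<open>H\<close> contains a transposition, \<open>H N = Sym n\<close>, that is, \<open>N\<close>
  is transitive on the cosets of \<open>H\<close>.
\<close>

section \<open>Right multiplication on the cosets of a subgroup\<close>

lemma opposite_group_simps [simp]:
  "carrier (opposite_group G) = carrier G"
  "mult (opposite_group G) = (\<lambda>x y. y \<otimes>\<^bsub>G\<^esub> x)"
  "one (opposite_group G) = \<one>\<^bsub>G\<^esub>"
  by (simp_all add: opposite_group_def)

lemma group_opposite_group:
  assumes "group G"
  shows "group (opposite_group G)"
proof -
  interpret group G by fact
  show ?thesis
    by (rule groupI) (auto simp: m_assoc intro: r_inv)
qed

locale coset_space = group G + subgroup H G for G (structure) and H
begin

text \<open>After \<open>m_assoc\<close> has moved all brackets to the right, an inverse pair may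
  have a further factor behind it; these rules let \<open>simp\<close> cancel it there.\<close>

lemma inv_cancel_left [simp]:
  "\<lbrakk>x \<in> carrier G; y \<in> carrier G\<rbrakk> \<Longrightarrow> x \<otimes> (inv x \<otimes> y) = y"
  "\<lbrakk>x \<in> carrier G; y \<in> carrier G\<rbrakk> \<Longrightarrow> inv x \<otimes> (x \<otimes> y) = y"
  by (simp_all flip: m_assoc)

lemma rcoset_eq_iff:
  assumes "x \<in> carrier G" "y \<in> carrier G"
  shows "H #> x = H #> y \<longleftrightarrow> (\<exists>h\<in>H. x = h \<otimes> y)"
proof
  assume "H #> x = H #> y"
  then have "x \<in> H #> y"
    using rcos_self[OF assms(1) subgroup_axioms] by simp
  then show "\<exists>h\<in>H. x = h \<otimes> y"
    by (auto simp: r_coset_def)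
next
  assume "\<exists>h\<in>H. x = h \<otimes> y"
  then have "x \<in> H #> y"
    by (auto simp: r_coset_def)
  then show "H #> x = H #> y"
    using repr_independence[OF _ assms(2) subgroup_axioms] by simp
qed

lemma rcoset_eq_iff':
  assumes "x \<in> carrier G" "y \<in> carrier G"
  shows "H #> x = H #> y \<longleftrightarrow> x \<otimes> inv y \<in> H"
proof -
  have "x = (x \<otimes> inv y) \<otimes> y"
    using assms by (simp add: m_assoc)
  moreover have "x \<otimes> inv y = h" if "x = h \<otimes> y" "h \<in> H" for h
    using that assms by (simp add: m_assoc)
  ultimately show ?thesis
    unfolding rcoset_eq_iff[OF assms] by metis
qed

lemma rcoset_mem_mult:
  "\<lbrakk>h \<in> H; x \<in> carrier G\<rbrakk> \<Longrightarrow> H #> (h \<otimes> x) = H #> x"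
  by (subst rcoset_eq_iff) auto

lemma rcoset_in_rcosets [simp]: "x \<in> carrier G \<Longrightarrow> H #> x \<in> rcosets H"
  by (auto simp: RCOSETS_def)

lemma rcosetsE:
  assumes "C \<in> rcosets H"
  obtains x where "x \<in> carrier G" "C = H #> x"
  using assms by (auto simp: RCOSETS_def)

lemma right_mult_action_rcoset [simp]:
  "\<lbrakk>x \<in> carrier G; g \<in> carrier G\<rbrakk> \<Longrightarrow> right_mult_action G H g (H #> x) = H #> (x \<otimes> g)"
  by (simp add: right_mult_action_def coset_mult_assoc subset)

lemma right_mult_action_in_Bij:
  assumes "g \<in> carrier G"
  shows "right_mult_action G H g \<in> Bij (rcosets H)"
proof -
  have "bij_betw (right_mult_action G H g) (rcosets H) (rcosets H)"
    using assms
    by (intro bij_betw_byWitness[where f' = "right_mult_action G H (inv g)"])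
      (auto elim!: rcosetsE simp: m_assoc)
  then show ?thesis
    by (simp add: Bij_def right_mult_action_def)
qed

text \<open>Acting by \<open>y\<close> and then by \<open>x\<close> is acting by
  \<open>y \<otimes> x\<close>, hence a homomorphism on the opposite group. Any subgroup
  \<open>N\<close> is allowed, so that the whole group and its normal subgroups are covered at
  once.\<close>

lemma group_action_right_mult:
  assumes "subgroup N G"
  shows "group_action (opposite_group (G\<lparr>carrier := N\<rparr>)) (rcosets H) (right_mult_action G H)"
proof -
  have N: "N \<subseteq> carrier G"
    using assms subgroup.subset by blast
  have "right_mult_action G H (y \<otimes> x) =
      compose (rcosets H) (right_mult_action G H x) (right_mult_action G H y)"
    if "x \<in> N" "y \<in> N" for x y
  proof
    fix C
    show "right_mult_action G H (y \<otimes> x) C =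
        compose (rcosets H) (right_mult_action G H x) (right_mult_action G H y) C"
    proof (cases "C \<in> rcosets H")
      case True
      then show ?thesis
        using that N by (auto elim!: rcosetsE simp: compose_def m_assoc subset_iff)
    next
      case False
      then show ?thesis
        by (simp add: compose_def right_mult_action_def)
    qed
  qed
  then have "right_mult_action G H \<in>
      hom (opposite_group (G\<lparr>carrier := N\<rparr>)) (BijGroup (rcosets H))"
    using N by (auto simp: hom_def BijGroup_def right_mult_action_in_Bij subset_iff)
  moreover have "group (opposite_group (G\<lparr>carrier := N\<rparr>))"
    using assms by (intro group_opposite_group subgroup_imp_group)
  ultimately show ?thesis
    by (simp add: group_action_def group_hom_def group_hom_axioms_def group_BijGroup)
qed

text \<open>To move \<open>H #> x\<close> to \<open>H #> y\<close>, factor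
  \<open>y \<otimes> inv x\<close> as \<open>h \<otimes> k\<close>. Then \<open>y\<close> is
  \<open>h \<otimes> x\<close> times \<open>inv x \<otimes> k \<otimes> x\<close>, and the latter
  lies in \<open>N\<close> by normality.\<close>

lemma transitive_right_mult:
  assumes "N \<lhd> G" "carrier G \<subseteq> H <#> N"
  shows "transitive_right_action (G\<lparr>carrier := N\<rparr>) (rcosets H) (right_mult_action G H)"
proof -
  interpret N: normal N G by fact
  have "\<exists>k\<in>N. right_mult_action G H k C = D" if C: "C \<in> rcosets H" and D: "D \<in> rcosets H" for C D
  proof -
    obtain x y where xy: "x \<in> carrier G" "C = H #> x" "y \<in> carrier G" "D = H #> y"
      using C D by (meson rcosetsE)
    have "y \<otimes> inv x \<in> H <#> N"
      using assms(2) xy by blast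
    then obtain h k where hk: "h \<in> H" "k \<in> N" "y \<otimes> inv x = h \<otimes> k"
      by (auto simp: set_mult_def)
    have y: "y = h \<otimes> (k \<otimes> x)"
      using hk xy inv_solve_right[of "h \<otimes> k" y x] by (simp add: m_assoc)
    have "inv x \<otimes> k \<otimes> x \<in> N"
      using N.inv_op_closed1 hk xy by blast
    moreover have "right_mult_action G H (inv x \<otimes> k \<otimes> x) C = H #> (k \<otimes> x)"
      using xy hk by (simp add: m_assoc)
    moreover have "H #> (k \<otimes> x) = D"
      using xy hk y by (simp add: rcoset_mem_mult)
    ultimately show ?thesis
      by metis
  qed
  then show ?thesis
    using group_action_right_mult[OF N.subgroup_axioms]
    by (simp add: transitive_right_action_def transitive_action_def transitive_action_axioms_def)
qed

text \<open>If \<open>g\<close> and \<open>k\<close> act alike, every conjugate of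
  \<open>g \<otimes> inv k\<close> lies in \<open>H\<close>. The hypothesis says that the core of
  \<open>H\<close> is trivial.\<close>

lemma faithful_right_mult:
  assumes core: "\<And>g. \<lbrakk>g \<in> carrier G; \<And>x. x \<in> carrier G \<Longrightarrow> x \<otimes> g \<otimes> inv x \<in> H\<rbrakk> \<Longrightarrow> g = \<one>"
  shows "faithful_right_action G (rcosets H) (right_mult_action G H)"
proof -
  have "inj_on (right_mult_action G H) (carrier G)"
  proof (rule inj_onI)
    fix g k
    assume gk: "g \<in> carrier G" "k \<in> carrier G"
      and eq: "right_mult_action G H g = right_mult_action G H k"
    have "x \<otimes> (g \<otimes> inv k) \<otimes> inv x \<in> H" if x: "x \<in> carrier G" for x
    proof -
      have "H #> (x \<otimes> g) = H #> (x \<otimes> k)"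
        using fun_cong[OF eq, of "H #> x"] x gk by simp
      then show ?thesis
        using x gk by (simp add: rcoset_eq_iff' m_assoc inv_mult_group)
    qed
    then have "g \<otimes> inv k = \<one>"
      using gk by (intro core) auto
    then show "g = k"
      using gk by (metis inv_closed inv_equality inv_inv)
  qed
  then show ?thesis
    using group_action_right_mult[OF subgroup_self]
    by (simp add: faithful_right_action_def faithful_action_def faithful_action_axioms_def)
qed

text \<open>The stabiliser of \<open>H #> x\<close> is the conjugate of \<open>H\<close> by
  \<open>x\<close>.\<close>

lemma card_stabilizer_right_mult:
  assumes "C \<in> rcosets H"
  shows "card (stabilizer G (right_mult_action G H) C) = card H"
proof -
  obtain x where x: "x \<in> carrier G" "C = H #> x"
    using assms by (rule rcosetsE)
  have *: "right_mult_action G H g C = C \<longleftrightarrow> x \<otimes> g \<otimes> inv x \<in> H" if "g \<in> carrier G" for g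
    using x that by (simp add: rcoset_eq_iff')
  then have "stabilizer G (right_mult_action G H) C = {g \<in> carrier G. x \<otimes> g \<otimes> inv x \<in> H}"
    by (auto simp: stabilizer_def)
  moreover have "bij_betw (\<lambda>h. inv x \<otimes> h \<otimes> x) H {g \<in> carrier G. x \<otimes> g \<otimes> inv x \<in> H}"
    using x(1)
    by (intro bij_betw_byWitness[where f' = "\<lambda>g. x \<otimes> g \<otimes> inv x"]) (auto simp: m_assoc)
  ultimately show ?thesis
    by (simp add: bij_betw_same_card)
qed

end

section \<open>Coset graphs oriented by an arc orbit\<close>

locale oriented_coset_graph = coset_space +
  fixes s
  assumes s_closed [simp]: "s \<in> carrier G"
    and asymmetric: "h \<in> H \<Longrightarrow> s \<otimes> h \<otimes> s \<notin> H"
begin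

text \<open>The orientation, parametrised by the element \<open>z\<close> that carries the base arc
  from \<open>H #> s\<close> to \<open>H\<close> onto the given arc.\<close>

definition arc_orbit :: "('a set \<times> 'a set) set" where
  "arc_orbit = {(H #> (s \<otimes> z), H #> z) | z. z \<in> carrier G}"

lemma pverts_coset_graph [simp]: "pverts (coset_graph G H s) = rcosets H"
  by (simp add: coset_graph_def Let_def)

text \<open>If \<open>x \<otimes> inv y\<close> is \<open>h \<otimes> s \<otimes> k\<close>, the two
  cosets have the representatives \<open>s \<otimes> (k \<otimes> y)\<close> and
  \<open>k \<otimes> y\<close>.\<close>

lemma arc_orbitI:
  assumes "x \<in> carrier G" "y \<in> carrier G" "x \<otimes> inv y \<in> (H #> s) <#> H"
  shows "(H #> x, H #> y) \<in> arc_orbit"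
proof -
  obtain h k where hk: "h \<in> H" "k \<in> H" "x \<otimes> inv y = h \<otimes> s \<otimes> k"
    using assms(3) by (auto simp: set_mult_def r_coset_def)
  have "x = h \<otimes> (s \<otimes> (k \<otimes> y))"
    using hk assms inv_solve_right[of "h \<otimes> s \<otimes> k" x y] by (simp add: m_assoc)
  then have "H #> x = H #> (s \<otimes> (k \<otimes> y))" "H #> y = H #> (k \<otimes> y)"
    using hk assms by (simp_all add: rcoset_mem_mult)
  then show ?thesis
    unfolding arc_orbit_def using hk assms(2) by (intro CollectI exI[of _ "k \<otimes> y"]) simp
qed

lemma parcs_coset_graph: "parcs (coset_graph G H s) = arc_orbit \<union> arc_orbit\<inverse>"
proof
  show "parcs (coset_graph G H s) \<subseteq> arc_orbit \<union> arc_orbit\<inverse>"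
    by (auto simp: coset_graph_def Let_def arc_orbitI)
next
  have "s \<in> (H #> s) <#> H"
    unfolding set_mult_def r_coset_def using one_closed
    by (auto intro!: bexI[of _ \<one>])
  then have "s \<otimes> z \<otimes> inv z \<in> (H #> s) <#> H" if "z \<in> carrier G" for z
    using that by (simp add: m_assoc)
  moreover have "(H #> x, H #> y) \<in> parcs (coset_graph G H s)"
    "(H #> y, H #> x) \<in> parcs (coset_graph G H s)"
    if "x \<in> carrier G" "y \<in> carrier G" "x \<otimes> inv y \<in> (H #> s) <#> H" for x y
    unfolding coset_graph_def Let_def using that by (simp, blast)+
  ultimately have "(H #> (s \<otimes> z), H #> z) \<in> parcs (coset_graph G H s)"
    "(H #> z, H #> (s \<otimes> z)) \<in> parcs (coset_graph G H s)" if "z \<in> carrier G" for z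
    using that by simp_all
  then show "arc_orbit \<union> arc_orbit\<inverse> \<subseteq> parcs (coset_graph G H s)"
    by (auto simp: arc_orbit_def)
qed

text \<open>An arc and its reverse would give \<open>s \<otimes> k \<otimes> s = h\<close> with
  \<open>h\<close> and \<open>k\<close> in \<open>H\<close>. The assumption
  \<open>asymmetric\<close> excludes this; it amounts to \<open>inv s\<close> lying outside the
  double coset of \<open>s\<close>.\<close>

lemma arc_orbit_asym: "(C, D) \<in> arc_orbit \<Longrightarrow> (D, C) \<notin> arc_orbit"
proof
  assume "(C, D) \<in> arc_orbit" "(D, C) \<in> arc_orbit"
  then obtain z w where zw: "z \<in> carrier G" "w \<in> carrier G"
    "H #> (s \<otimes> z) = H #> w" "H #> z = H #> (s \<otimes> w)"
    by (auto simp: arc_orbit_def)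
  obtain h k where hk: "h \<in> H" "k \<in> H" "s \<otimes> z = h \<otimes> w" "z = k \<otimes> (s \<otimes> w)"
    using zw rcoset_eq_iff[of "s \<otimes> z" w] rcoset_eq_iff[of z "s \<otimes> w"] by auto
  have "s \<otimes> k \<otimes> s \<otimes> w = h \<otimes> w"
    using hk zw by (simp add: m_assoc)
  then have "s \<otimes> k \<otimes> s = h"
    using hk zw by simp
  then show False
    using asymmetric hk by blast
qed

lemma arc_orbit_in_rcosets: "arc_orbit \<subseteq> (rcosets H) \<times> (rcosets H)"
  by (auto simp: arc_orbit_def)

lemma arc_orbit_eq_orbit:
  "arc_orbit = Group_Action.orbit G (\<lambda>g. map_prod (right_mult_action G H g) (right_mult_action G H g))
    (H #> s, H #> \<one>)"
proof -
  have "(H #> (s \<otimes> z), H #> z) =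
      map_prod (right_mult_action G H z) (right_mult_action G H z) (H #> s, H #> \<one>)"
    if "z \<in> carrier G" for z
    using that by simp
  then show ?thesis
    unfolding arc_orbit_def Group_Action.orbit_def by (metis (no_types, lifting))
qed

lemma arc_orbit_transitive:
  assumes "(C, D) \<in> arc_orbit" "(C', D') \<in> arc_orbit"
  shows "\<exists>g\<in>carrier G. right_mult_action G H g C = C' \<and> right_mult_action G H g D = D'"
proof -
  obtain z w where zw: "z \<in> carrier G" "C = H #> (s \<otimes> z)" "D = H #> z"
    "w \<in> carrier G" "C' = H #> (s \<otimes> w)" "D' = H #> w"
    using assms by (auto simp: arc_orbit_def)
  then show ?thesis
    by (intro bexI[of _ "inv z \<otimes> w"]) (auto simp: m_assoc)
qed

lemma right_mult_arc_orbit: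
  assumes "(C, D) \<in> arc_orbit" "g \<in> carrier G"
  shows "(right_mult_action G H g C, right_mult_action G H g D) \<in> arc_orbit"
proof -
  obtain z where "z \<in> carrier G" "C = H #> (s \<otimes> z)" "D = H #> z"
    using assms by (auto simp: arc_orbit_def)
  then show ?thesis
    using assms(2) by (auto simp: arc_orbit_def m_assoc intro!: exI[of _ "z \<otimes> g"])
qed

lemma right_mult_inv:
  assumes "C \<in> rcosets H" "g \<in> carrier G"
  shows "right_mult_action G H (inv g) (right_mult_action G H g C) = C"
  using assms by (auto elim!: rcosetsE simp: m_assoc)

lemma graph_automorphism_right_mult:
  assumes "g \<in> carrier G"
  shows "graph_automorphism (coset_graph G H s) (right_mult_action G H g)"
proof -
  have "(C, D) \<in> arc_orbit \<longleftrightarrow> (right_mult_action G H g C, right_mult_action G H g D) \<in> arc_orbit"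
    if "C \<in> rcosets H" "D \<in> rcosets H" for C D
    using that assms right_mult_arc_orbit right_mult_inv by (metis inv_closed)
  then show ?thesis
    using right_mult_action_in_Bij[OF assms]
    by (auto simp: graph_automorphism_def parcs_coset_graph Bij_def)
qed

lemma edge_transitive_right_mult: "edge_transitive G (coset_graph G H s) (right_mult_action G H)"
  unfolding edge_transitive_def
proof clarify
  fix C D C' D'
  assume CD: "(C, D) \<in> parcs (coset_graph G H s)" and CD': "(C', D') \<in> parcs (coset_graph G H s)"
  obtain A B where AB: "(A, B) \<in> arc_orbit" "(C, D) = (A, B) \<or> (C, D) = (B, A)"
    using CD unfolding parcs_coset_graph by blast
  obtain A' B' where AB': "(A', B') \<in> arc_orbit" "{C', D'} = {A', B'}"
    using CD' unfolding parcs_coset_graph by blast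
  obtain g where g: "g \<in> carrier G"
    "right_mult_action G H g A = A'" "right_mult_action G H g B = B'"
    using arc_orbit_transitive[OF AB(1) AB'(1)] by blast
  then have "{right_mult_action G H g C, right_mult_action G H g D} = {C', D'}"
    using AB(2) unfolding AB'(2) by auto
  then show "\<exists>g\<in>carrier G. {right_mult_action G H g C, right_mult_action G H g D} = {C', D'}"
    using g(1) by (rule bexI)
qed

lemma oriented_right_mult: "oriented G (coset_graph G H s) (right_mult_action G H)"
proof -
  have "arc_orbit \<in> orbits G ((rcosets H) \<times> (rcosets H))
      (\<lambda>g. map_prod (right_mult_action G H g) (right_mult_action G H g))"
    unfolding orbits_def arc_orbit_eq_orbit by (intro CollectI exI[of _ "(H #> s, H #> \<one>)"]) simp
  moreover have "arc_orbit \<inter> arc_orbit\<inverse> = {}"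
    using arc_orbit_asym by blast
  ultimately show ?thesis
    unfolding oriented_def parcs_coset_graph pverts_coset_graph by blast
qed

lemma pair_graph_coset_graph:
  assumes "finite (carrier G)"
  shows "pair_graph (coset_graph G H s)"
proof -
  have "finite (rcosets H)"
    using assms by (simp add: RCOSETS_def)
  moreover have "finite (parcs (coset_graph G H s))"
    using calculation arc_orbit_in_rcosets
    by (auto simp: parcs_coset_graph intro: finite_subset)
  \<comment> \<open>A loop would be its own reverse.\<close>
  moreover have "(C, C) \<notin> arc_orbit" for C
    using arc_orbit_asym by blast
  ultimately show ?thesis
    using arc_orbit_in_rcosets
    by unfold_locales
      (auto simp: parcs_coset_graph Digraph.symmetric_def sym_def)
qed

text \<open>The fibres of \<open>h \<mapsto> H #> (t \<otimes> h \<otimes> x)\<close> on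
  \<open>H\<close> are the right cosets of the subgroup of those \<open>h\<close> with
  \<open>t \<otimes> h \<otimes> inv t \<in> H\<close>. The hypotheses say that it has index 2, with
  \<open>a\<close> outside it.\<close>

lemma card_rcosets_two:
  assumes "t \<in> carrier G" "a \<in> H" "x \<in> carrier G" "t \<otimes> a \<otimes> inv t \<notin> H"
    and index: "\<And>h. h \<in> H \<Longrightarrow> t \<otimes> h \<otimes> inv t \<in> H \<or> t \<otimes> (h \<otimes> inv a) \<otimes> inv t \<in> H"
  shows "card {H #> (t \<otimes> h \<otimes> x) | h. h \<in> H} = 2"
proof -
  define f where "f h = H #> (t \<otimes> h \<otimes> x)" for h
  have eq: "f h = f k \<longleftrightarrow> t \<otimes> (h \<otimes> inv k) \<otimes> inv t \<in> H" if "h \<in> H" "k \<in> H" for h k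
  proof -
    have "t \<otimes> h \<otimes> x \<otimes> inv (t \<otimes> k \<otimes> x) = t \<otimes> (h \<otimes> inv k) \<otimes> inv t"
      using assms(1,3) that by (simp add: m_assoc inv_mult_group)
    then show ?thesis
      using assms(1,3) that by (simp add: f_def rcoset_eq_iff')
  qed
  have "f h = f \<one> \<or> f h = f a" if "h \<in> H" for h
    using index[OF that] eq[OF that one_closed] eq[OF that assms(2)] that by simp
  then have "f ` H = {f \<one>, f a}"
    using one_closed assms(2) by (intro equalityI subsetI) auto
  moreover have "f a \<noteq> f \<one>"
    using eq[OF assms(2) one_closed] assms(2,4) by simp
  ultimately have "card (f ` H) = 2"
    by simp
  then show ?thesis
    by (simp add: f_def Setcompr_eq_image)
qed

text \<open>In the orientation, \<open>A\<close> collects the in-neighbours of \<open>C\<close> and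
  \<open>B\<close> its out-neighbours. Each has two elements, and they are disjoint by asymmetry.
  The out-degree counts both, since every edge is stored in both directions.\<close>

lemma out_degree_coset_graph:
  assumes "C \<in> rcosets H"
    and "a \<in> H" "s \<otimes> a \<otimes> inv s \<notin> H"
    and "\<And>h. h \<in> H \<Longrightarrow> s \<otimes> h \<otimes> inv s \<in> H \<or> s \<otimes> (h \<otimes> inv a) \<otimes> inv s \<in> H"
    and "b \<in> H" "inv s \<otimes> b \<otimes> s \<notin> H"
    and "\<And>h. h \<in> H \<Longrightarrow> inv s \<otimes> h \<otimes> s \<in> H \<or> inv s \<otimes> (h \<otimes> inv b) \<otimes> s \<in> H"
  shows "out_degree (with_proj (coset_graph G H s)) C = 4"
proof -
  obtain x where x: "x \<in> carrier G" "C = H #> x"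
    using assms(1) by (rule rcosetsE)
  define A where "A = {H #> (s \<otimes> h \<otimes> x) | h. h \<in> H}"
  define B where "B = {H #> (inv s \<otimes> h \<otimes> x) | h. h \<in> H}"
  have A: "(D, C) \<in> arc_orbit \<longleftrightarrow> D \<in> A" for D
  proof
    assume "(D, C) \<in> arc_orbit"
    then obtain z where z: "z \<in> carrier G" "D = H #> (s \<otimes> z)" "H #> z = H #> x"
      using x by (auto simp: arc_orbit_def)
    then obtain h where "h \<in> H" "z = h \<otimes> x"
      using rcoset_eq_iff x by blast
    then show "D \<in> A"
      using z x by (auto simp: A_def m_assoc intro!: exI[of _ h])
  next
    assume "D \<in> A"
    then obtain h where "h \<in> H" "D = H #> (s \<otimes> h \<otimes> x)"
      by (auto simp: A_def)
    then show "(D, C) \<in> arc_orbit"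
      using x by (auto simp: arc_orbit_def m_assoc rcoset_mem_mult intro!: exI[of _ "h \<otimes> x"])
  qed
  have B: "(C, D) \<in> arc_orbit \<longleftrightarrow> D \<in> B" for D
  proof
    assume "(C, D) \<in> arc_orbit"
    then obtain z where z: "z \<in> carrier G" "D = H #> z" "H #> (s \<otimes> z) = H #> x"
      using x by (auto simp: arc_orbit_def)
    then obtain h where h: "h \<in> H" "s \<otimes> z = h \<otimes> x"
      using rcoset_eq_iff[of "s \<otimes> z" x] x by auto
    then have "inv s \<otimes> (s \<otimes> z) = inv s \<otimes> (h \<otimes> x)"
      by simp
    then have "z = inv s \<otimes> h \<otimes> x"
      using h(1) z(1) x(1) by (simp add: m_assoc)
    then show "D \<in> B"
      using z(2) h(1) by (auto simp: B_def)
  next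
    assume "D \<in> B"
    then obtain h where "h \<in> H" "D = H #> (inv s \<otimes> h \<otimes> x)"
      by (auto simp: B_def)
    then show "(C, D) \<in> arc_orbit"
      using x by (auto simp: arc_orbit_def m_assoc rcoset_mem_mult
        intro!: exI[of _ "inv s \<otimes> (h \<otimes> x)"])
  qed
  have "card A = 2"
    unfolding A_def using assms(2-4) x(1) by (intro card_rcosets_two[of s a x]) simp_all
  moreover have "card B = 2"
    unfolding B_def using assms(5-7) x(1) by (intro card_rcosets_two[of "inv s" b x]) simp_all
  ultimately have card_AB: "card A = 2" "card B = 2" "finite A" "finite B"
    by (simp_all add: card_ge_0_finite)
  have "out_arcs (with_proj (coset_graph G H s)) C = Pair C ` (A \<union> B)"
    using A B by (force simp: out_arcs_def parcs_coset_graph)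
  then have "out_degree (with_proj (coset_graph G H s)) C = card (A \<union> B)"
    by (simp add: out_degree_def card_image inj_on_def)
  also have "\<dots> = card A + card B"
  proof (rule card_Un_disjoint)
    show "finite A" "finite B"
      by fact+
    show "A \<inter> B = {}"
      using A B arc_orbit_asym by blast
  qed
  also have "\<dots> = 4"
    by (simp add: card_AB)
  finally show ?thesis .
qed

text \<open>Left multiplication by an element of \<open>H\<close> keeps the coset, and by
  \<open>s\<close> or its inverse it moves along an edge. Induction over the generated subgroup thus
  joins \<open>H #> (t \<otimes> x)\<close> to \<open>H #> x\<close>; the product case needs this
  for all \<open>x\<close> at once.\<close>

lemma connected_coset_graph:
  assumes "carrier G = generate G (insert s H)"
  shows "connected (with_proj (coset_graph G H s))"
proof -
  let ?\<Gamma> = "coset_graph G H s"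
  interpret pair_wf_digraph ?\<Gamma>
    using arc_orbit_in_rcosets by unfold_locales (auto simp: parcs_coset_graph)
  have sym: "Digraph.symmetric (with_proj ?\<Gamma>)"
    by (auto simp: parcs_coset_graph Digraph.symmetric_def sym_def)
  have arc: "(H #> (s \<otimes> x)) \<rightarrow>\<^sup>*\<^bsub>with_proj ?\<Gamma>\<^esub> (H #> x)"
    "(H #> x) \<rightarrow>\<^sup>*\<^bsub>with_proj ?\<Gamma>\<^esub> (H #> (s \<otimes> x))"
    if "x \<in> carrier G" for x
    using that by (auto intro!: reachable_adjI simp: parcs_coset_graph arc_orbit_def)
  have in_carrier: "t \<in> carrier G" if "t \<in> generate G (insert s H)" for t
    using that assms by simp
  have "\<forall>x\<in>carrier G. (H #> (t \<otimes> x)) \<rightarrow>\<^sup>*\<^bsub>with_proj ?\<Gamma>\<^esub> (H #> x)"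
    if "t \<in> generate G (insert s H)" for t
    using that
  proof induction
    case one
    then show ?case
      by (auto intro: reachable_refl)
  next
    case (incl h)
    then show ?case
      using arc by (auto simp: rcoset_mem_mult intro: reachable_refl)
  next
    case (inv h)
    show ?case
    proof
      fix x
      assume x: "x \<in> carrier G"
      show "(H #> (inv h \<otimes> x)) \<rightarrow>\<^sup>*\<^bsub>with_proj ?\<Gamma>\<^esub> (H #> x)"
        using inv x arc(2)[of "inv s \<otimes> x"]
        by (auto simp: rcoset_mem_mult intro: reachable_refl)
    qed
  next
    case (eng t u)
    show ?case
    proof
      fix x
      assume x: "x \<in> carrier G"
      have "(H #> (t \<otimes> (u \<otimes> x))) \<rightarrow>\<^sup>*\<^bsub>with_proj ?\<Gamma>\<^esub> (H #> (u \<otimes> x))"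
        using eng x in_carrier by blast
      also have "(H #> (u \<otimes> x)) \<rightarrow>\<^sup>*\<^bsub>with_proj ?\<Gamma>\<^esub> (H #> x)"
        using eng x by blast
      finally show "(H #> (t \<otimes> u \<otimes> x)) \<rightarrow>\<^sup>*\<^bsub>with_proj ?\<Gamma>\<^esub> (H #> x)"
        using eng x in_carrier by (simp add: m_assoc)
    qed
  qed
  note reach_one = this
  have reach: "C \<rightarrow>\<^sup>*\<^bsub>with_proj ?\<Gamma>\<^esub> D" if CD: "C \<in> rcosets H" "D \<in> rcosets H" for C D
  proof -
    obtain x y where xy: "x \<in> carrier G" "C = H #> x" "y \<in> carrier G" "D = H #> y"
      using CD by (meson rcosetsE)
    then have "x \<otimes> inv y \<in> generate G (insert s H)"
      using assms by auto
    then have "(H #> (x \<otimes> inv y \<otimes> y)) \<rightarrow>\<^sup>*\<^bsub>with_proj ?\<Gamma>\<^esub> (H #> y)"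
      using reach_one xy by blast
    then show ?thesis
      using xy by (simp add: m_assoc)
  qed
  \<comment> \<open>Strong connectedness includes that the vertex set is nonempty.\<close>
  have "H #> s \<in> rcosets H"
    by simp
  then have "strongly_connected (with_proj ?\<Gamma>)"
    unfolding strongly_connected_def with_proj_simps pverts_coset_graph using reach by blast
  then show ?thesis
    using sym by (simp add: connected_def strongly_connected_def reachable_mk_symmetric_eq)
qed

end

section \<open>The symmetric group with products read left to right\<close>

lemma Sym_simps [simp]:
  "carrier (Sym n) = {p. p permutes {1..n}}"
  "p \<otimes>\<^bsub>Sym n\<^esub> q = q \<circ> p"
  "\<one>\<^bsub>Sym n\<^esub> = id"
  by (simp_all add: Sym_def opposite_group_def sym_group_def)

lemma group_Sym: "group (Sym n)"
  unfolding Sym_def by (intro group_opposite_group sym_group_is_group)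

lemma inv_Sym [simp]:
  assumes "p permutes {1..n}"
  shows "inv\<^bsub>Sym n\<^esub> p = inv' p"
  using assms permutes_inv[OF assms] permutes_inv_o[OF assms]
  by (intro group.inv_equality[OF group_Sym]) simp_all

text \<open>Restated through composition and inverse functions, so that later arguments need not
  follow the reversed product.\<close>

lemma subgroup_Sym_closed:
  assumes "subgroup K (Sym n)"
  shows "id \<in> K"
    and "p \<in> K \<Longrightarrow> p permutes {1..n}"
    and "\<lbrakk>p \<in> K; q \<in> K\<rbrakk> \<Longrightarrow> p \<circ> q \<in> K"
    and "p \<in> K \<Longrightarrow> inv' p \<in> K"
proof -
  interpret subgroup K "Sym n" by fact
  show "id \<in> K"
    using one_closed by simp
  show perm: "p permutes {1..n}" if "p \<in> K" for p
    using mem_carrier[OF that] by simp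
  show "p \<circ> q \<in> K" if "p \<in> K" "q \<in> K"
    using m_closed[OF that(2,1)] by simp
  show "inv' p \<in> K" if "p \<in> K"
    using m_inv_closed[OF that] perm[OF that] by simp
qed

section \<open>Normal subgroups of the symmetric group, and generation by transpositions\<close>

lemma conj_transpose:
  assumes "bij p"
  shows "p \<circ> transpose a b \<circ> inv' p = transpose (p a) (p b)"
proof -
  have "p \<circ> transpose a b = transpose (p a) (p b) \<circ> p"
    using transpose_comp_eq[OF assms, of "p a" "p b"] assms by (simp add: bij_is_inj)
  then show ?thesis
    using assms by (simp add: comp_assoc bij_is_surj surj_iff[THEN iffD1])
qed

text \<open>Read left to right, this conjugate has the inverse of \<open>p\<close> first, which is
  the form of \<open>inv_op_closed1\<close>.\<close>

lemma normal_Sym_conj: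
  assumes "N \<lhd> Sym n" "p permutes {1..n}" "q \<in> N"
  shows "p \<circ> q \<circ> inv' p \<in> N"
  using normal.inv_op_closed1[OF assms(1), of p q] assms by (simp add: comp_assoc)

lemma normal_Sym_transpose_conj:
  assumes "N \<lhd> Sym n" "p permutes {1..n}" "transpose a b \<circ> transpose c d \<in> N"
  shows "transpose (p a) (p b) \<circ> transpose (p c) (p d) \<in> N"
proof -
  have p: "bij p"
    using assms(2) permutes_bij by blast
  have "transpose (p a) (p b) \<circ> transpose (p c) (p d) =
      p \<circ> (transpose a b \<circ> transpose c d) \<circ> inv' p"
    unfolding conj_transpose[OF p, symmetric] using p by (auto simp: fun_eq_iff bij_is_inj)
  then show ?thesis
    using normal_Sym_conj[OF assms] by simp
qed

text \<open>
  The commutator of an element of \<open>N\<close> and a transposition is a product of two distinct transpositions.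
  If these are disjoint, conjugating by a transposition that moves a fifth point gives two that overlap.
\<close>

lemma normal_Sym_transpose_pair:
  assumes N: "N \<lhd> Sym n" and "N \<noteq> {id}" and "n \<ge> 5"
  obtains a b c where "a \<in> {1..n}" "b \<in> {1..n}" "c \<in> {1..n}" "a \<noteq> b" "a \<noteq> c" "b \<noteq> c"
    "transpose a b \<circ> transpose a c \<in> N"
proof -
  note sub = subgroup_Sym_closed[OF normal_imp_subgroup[OF N]]
  obtain x where x: "x \<in> N" "x \<noteq> id"
    using sub(1) assms(2) by auto
  then obtain i where i: "x i \<noteq> i"
    by (auto simp: fun_eq_iff)
  have perm: "x permutes {1..n}"
    using sub x by blast
  then have iS: "i \<in> {1..n}" "x i \<in> {1..n}"
    using i permutes_not_in permutes_in_image by metis+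
  \<comment> \<open>A point \<open>k\<close> outside \<open>{i, x i}\<close> makes
    \<open>transpose i k\<close> differ from its conjugate by \<open>x\<close>, because
    \<open>x i\<close> is neither \<open>i\<close> nor \<open>k\<close>.\<close>
  have "card {i, x i} < card {1..n}"
    using i assms(3) by simp
  then have "\<not> {1..n} \<subseteq> {i, x i}"
    using card_mono[of "{i, x i}" "{1..n}"] by auto
  then obtain k where k: "k \<in> {1..n}" "k \<noteq> i" "k \<noteq> x i"
    by blast
  have kS: "x k \<in> {1..n}"
    using k perm permutes_in_image by metis
  have neq: "x k \<noteq> x i"
    using k permutes_inj[OF perm] by (auto dest: injD)
  have "transpose i k \<circ> inv' x \<circ> inv' (transpose i k) \<in> N"
    using iS k x sub by (intro normal_Sym_conj[OF N]) (auto intro: permutes_swap_id)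
  then have "x \<circ> (transpose i k \<circ> inv' x \<circ> transpose i k) \<in> N"
    using sub(3) x by simp
  then have comm: "transpose (x i) (x k) \<circ> transpose i k \<in> N"
    using conj_transpose[of x i k] permutes_bij[OF perm] by (metis comp_assoc)
  \<comment> \<open>In the first two cases the transpositions in \<open>comm\<close> already share
    the point \<open>x k\<close>; in the third they are disjoint.\<close>
  consider "x k = i" | "x k = k" | "x k \<noteq> i" "x k \<noteq> k"
    by blast
  then show thesis
  proof cases
    case 1
    then show thesis
      using comm i k iS by (intro that[of i "x i" k]) (auto simp: transpose_commute)
  next
    case 2
    then show thesis
      using comm i k iS by (intro that[of k "x i" i]) (auto simp: transpose_commute)
  next
    case 3
    have "card {i, x i, k, x k} < card {1..n}"
      using assms(3) card_insert_le_m1[of 4 "{x i, k, x k}" i]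
      by (simp add: card_insert_if)
    then have "\<not> {1..n} \<subseteq> {i, x i, k, x k}"
      using card_mono[of "{i, x i, k, x k}" "{1..n}"] by auto
    then obtain e where e: "e \<in> {1..n}" "e \<noteq> i" "e \<noteq> x i" "e \<noteq> k" "e \<noteq> x k"
      by blast
    \<comment> \<open>Conjugation by \<open>transpose k e\<close> affects only the second factor, so
      dividing by \<open>comm\<close> cancels the first.\<close>
    have "transpose (x i) (x k) \<circ> transpose i e \<in> N"
      using normal_Sym_transpose_conj[OF N permutes_swap_id[OF k(1) e(1)] comm] i k e neq 3
      by simp
    then have "inv' (transpose (x i) (x k) \<circ> transpose i k) \<circ> (transpose (x i) (x k) \<circ> transpose i e) \<in> N"
      using sub comm by blast
    then have "transpose i k \<circ> transpose i e \<in> N"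
      by (simp add: o_inv_distrib comp_assoc) (simp flip: comp_assoc)
    then show thesis
      using iS k e by (intro that[of i k e]) auto
  qed
qed

text \<open>\<open>E a b c d\<close> says that two transpositions agree modulo \<open>N\<close>.
  This is an equivalence relation preserved by conjugation; one overlapping pair spreads to all
  transpositions through \<open>a\<close>, and from there to all others.\<close>

lemma normal_Sym_transpositions:
  assumes N: "N \<lhd> Sym n" and "N \<noteq> {id}" and "n \<ge> 5"
    and xy: "x \<in> {1..n}" "y \<in> {1..n}" "x \<noteq> y" and uv: "u \<in> {1..n}" "v \<in> {1..n}" "u \<noteq> v"
  shows "transpose x y \<circ> transpose u v \<in> N"
proof -
  note sub = subgroup_Sym_closed[OF normal_imp_subgroup[OF N]]
  define E where "E = (\<lambda>a b c d. transpose a b \<circ> transpose c d \<in> N)"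
  have E_refl: "E a b a b" for a b
    using sub by (simp add: E_def)
  have E_trans: "E a b e f" if "E a b c d" "E c d e f" for a b c d e f
  proof -
    have "transpose a b \<circ> transpose c d \<circ> (transpose c d \<circ> transpose e f) \<in> N"
      using that sub unfolding E_def by blast
    then show ?thesis
      unfolding E_def by (simp add: comp_assoc) (simp flip: comp_assoc)
  qed
  have E_sym: "E c d a b" if "E a b c d" for a b c d
    using that sub(4)[of "transpose a b \<circ> transpose c d"] by (simp add: E_def o_inv_distrib)
  have E_conj: "E (transpose p q a) (transpose p q b) (transpose p q c) (transpose p q d)"
    if "E a b c d" "p \<in> {1..n}" "q \<in> {1..n}" for a b c d p q
    using normal_Sym_transpose_conj[OF N permutes_swap_id[OF that(2,3)]] that(1)
    unfolding E_def by blast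
  obtain a b c where abc: "a \<in> {1..n}" "b \<in> {1..n}" "c \<in> {1..n}" "a \<noteq> b" "a \<noteq> c" "b \<noteq> c"
    "E a b a c"
    using normal_Sym_transpose_pair[OF assms(1-3)] unfolding E_def by metis
  \<comment> \<open>Conjugation by \<open>transpose c d\<close> fixes \<open>a\<close> and moves
    \<open>c\<close> to \<open>d\<close>. It also fixes \<open>b\<close> unless
    \<open>d = b\<close>, where reflexivity suffices.\<close>
  have star: "E a b a d" if "d \<in> {1..n}" "d \<noteq> a" for d
    using E_conj[OF abc(7) abc(3) that(1)] abc that E_refl
    by (cases "d = b") (auto simp: transpose_def)
  have all: "E a b x y" if "x \<in> {1..n}" "y \<in> {1..n}" "x \<noteq> y" for x y
  proof -
    consider "x = a" | "y = a" | "x \<noteq> a" "y \<noteq> a"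
      by blast
    then show ?thesis
    proof cases
      case 1
      then show ?thesis
        using star that by simp
    next
      case 2
      then show ?thesis
        using star[of x] that unfolding E_def transpose_commute[of x y] by simp
    next
      case 3
      have "E a x a y"
        using E_trans[OF E_sym[OF star[of x]] star[of y]] 3 that by simp
      \<comment> \<open>Conjugating by \<open>transpose a x\<close> links a transposition through
        \<open>a\<close> to one avoiding it.\<close>
      then have "E x a x y"
        using E_conj[of a x a y a x] abc(1) that 3 by simp
      then have "E a x x y"
        unfolding E_def transpose_commute[of a x] .
      then show ?thesis
        using E_trans[OF star[of x]] 3 that by simp
    qed
  qed
  have "E x y u v"
    using E_trans[OF E_sym[OF all[OF xy]] all[OF uv]] .
  then show ?thesis
    unfolding E_def .
qed

text \<open>Modulo \<open>N\<close> every transposition equals \<open>transpose a b\<close>, so each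
  further factor of a product of transpositions only exchanges the two alternatives.\<close>

lemma Sym_eq_normal_transpose:
  assumes N: "N \<lhd> Sym n" and "N \<noteq> {id}" and "n \<ge> 5"
    and ab: "a \<in> {1..n}" "b \<in> {1..n}" "a \<noteq> b" and p: "p permutes {1..n}"
  shows "p \<in> N \<or> p \<circ> transpose a b \<in> N"
  using finite_atLeastAtMost p
proof (induction rule: permutes_rev_induct)
  case id
  then show ?case
    using subgroup_Sym_closed(1)[OF normal_imp_subgroup[OF N]] by blast
next
  case (swap c d p)
  note sub = subgroup_Sym_closed[OF normal_imp_subgroup[OF N]]
  show ?case
  proof (cases "c = d")
    case True
    then show ?thesis
      using swap by simp
  next
    case False
    then have cd: "transpose c d \<circ> transpose a b \<in> N" "transpose a b \<circ> transpose c d \<in> N"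
      using normal_Sym_transpositions[OF assms(1-3)] swap ab by simp_all
    consider "p \<in> N" | "p \<circ> transpose a b \<in> N"
      using swap by blast
    then show ?thesis
    proof cases
      case 1
      then show ?thesis
        using sub(3)[OF 1 cd(1)] by (metis comp_assoc)
    next
      case 2
      have "p \<circ> transpose a b \<circ> (transpose a b \<circ> transpose c d) \<in> N"
        using sub(3)[OF 2 cd(2)] .
      moreover have "p \<circ> transpose a b \<circ> (transpose a b \<circ> transpose c d) = p \<circ> transpose c d"
        by (simp add: fun_eq_iff)
      ultimately show ?thesis
        by metis
    qed
  qed
qed

lemma Sym_subgroup_mult_normal:
  assumes "N \<lhd> Sym n" "N \<noteq> {id}" "n \<ge> 5" "subgroup K (Sym n)"
    and "transpose a b \<in> K" "a \<in> {1..n}" "b \<in> {1..n}" "a \<noteq> b"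
  shows "carrier (Sym n) \<subseteq> K <#>\<^bsub>Sym n\<^esub> N"
proof
  fix p
  assume "p \<in> carrier (Sym n)"
  then consider "p \<in> N" | "p \<circ> transpose a b \<in> N"
    using Sym_eq_normal_transpose[OF assms(1-3,6-8)] by auto
  then show "p \<in> K <#>\<^bsub>Sym n\<^esub> N"
  proof cases
    case 1
    then show ?thesis
      using subgroup_Sym_closed(1)[OF assms(4)] unfolding set_mult_def
      by (intro UN_I[of id] UN_I[of p]) auto
  next
    case 2
    \<comment> \<open>The left factor of the group product is the function applied first.\<close>
    have "p = transpose a b \<otimes>\<^bsub>Sym n\<^esub> (p \<circ> transpose a b)"
      by (simp add: comp_assoc)
    then show ?thesis
      using 2 assms(5) unfolding set_mult_def by blast
  qed
qed

text \<open>Conjugating \<open>transpose i j\<close> by \<open>transpose j (Suc j)\<close> gives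
  \<open>transpose i (Suc j)\<close>, so adjacent transpositions yield all transpositions.\<close>

lemma subgroup_Sym_eq_carrier:
  assumes "subgroup K (Sym n)"
    and adj: "\<And>i. \<lbrakk>1 \<le> i; i < n\<rbrakk> \<Longrightarrow> transpose i (Suc i) \<in> K"
  shows "K = carrier (Sym n)"
proof
  note sub = subgroup_Sym_closed[OF assms(1)]
  show "K \<subseteq> carrier (Sym n)"
    using sub by auto
  have up: "transpose i j \<in> K" if "1 \<le> i" "i < j" "j \<le> n" for i j
    using that(2,3)
  proof (induction j)
    case (Suc j)
    show ?case
    proof (cases "i = j")
      case True
      then show ?thesis
        using adj that(1) Suc.prems by simp
    next
      case False
      then have "transpose j (Suc j) \<circ> transpose i j \<circ> transpose j (Suc j) = transpose i (Suc j)"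
        using Suc.prems by (auto simp: fun_eq_iff transpose_def)
      moreover have "transpose j (Suc j) \<circ> transpose i j \<circ> transpose j (Suc j) \<in> K"
        using Suc False that(1) adj[of j] sub(3) by simp
      ultimately show ?thesis
        by simp
    qed
  qed simp
  have "p \<in> K" if "p permutes {1..n}" for p
    using that finite_atLeastAtMost
  proof (induction rule: permutes_induct)
    case id
    then show ?case
      using sub(1) by blast
  next
    case (swap a b p)
    have "transpose a b \<in> K"
      using swap up[of a b] up[of b a] sub(1)
      by (cases a b rule: linorder_cases) (auto simp: transpose_commute)
    then show ?case
      using swap.IH sub(3) by blast
  qed
  then show "carrier (Sym n) \<subseteq> K"
    by auto
qed

section \<open>The elementary abelian group generated by the transpositions
  \<open>(i, i + m)\<close>\<close>

text \<open>The partner of \<open>i\<close> under the product of all \<open>(i, i + m)\<close>.\<close>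

definition opposite_point :: "nat \<Rightarrow> nat \<Rightarrow> nat" where
  "opposite_point m i =
    (if i \<in> {1..m} then i + m else if i \<in> {m + 1..2 * m} then i - m else i)"

text \<open>For \<open>S\<close> within \<open>{1..m}\<close> this is the product of the
  transpositions \<open>(i, i + m)\<close> with \<open>i\<close> in \<open>S\<close>.\<close>

definition flips :: "nat \<Rightarrow> nat set \<Rightarrow> nat \<Rightarrow> nat" where
  "flips m S i = (if i \<in> S \<or> opposite_point m i \<in> S then opposite_point m i else i)"

text \<open>The group \<open>H\<close> of the theorem, given by a pointwise condition that is easier
  to test than generation; \<open>generate_flips\<close> identifies the two.\<close>

definition flip_group :: "nat \<Rightarrow> nat \<Rightarrow> (nat \<Rightarrow> nat) set" where
  "flip_group n m = {h. h permutes {1..n} \<and> (\<forall>i. h i \<in> {i, opposite_point m i})}"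

lemma opposite_point_invol [simp]: "opposite_point m (opposite_point m i) = i"
  by (auto simp: opposite_point_def)

text \<open>For the last claim: if \<open>h\<close> fixed one point of a pair and moved the other,
  both would have the same image.\<close>

lemma flip_groupD:
  assumes "h \<in> flip_group n m"
  shows "h permutes {1..n}" and "h i = i \<or> h i = opposite_point m i"
    and "h (opposite_point m i) = opposite_point m (h i)"
proof -
  show h: "h permutes {1..n}" and 1: "h i = i \<or> h i = opposite_point m i" for i
    using assms by (auto simp: flip_group_def)
  show "h (opposite_point m i) = opposite_point m (h i)"
    using 1[of i] 1[of "opposite_point m i"] permutes_inj[OF h] opposite_point_invol
    by (metis injD)
qed

lemma subgroup_flip_group: "subgroup (flip_group n m) (Sym n)"
proof
  show "flip_group n m \<subseteq> carrier (Sym n)"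
    by (auto simp: flip_group_def)
  show "\<one>\<^bsub>Sym n\<^esub> \<in> flip_group n m"
    by (simp add: flip_group_def permutes_id)
next
  fix p q
  assume pq: "p \<in> flip_group n m" "q \<in> flip_group n m"
  have "q (p i) \<in> {i, opposite_point m i}" for i
    using flip_groupD(2)[OF pq(1), of i] flip_groupD(2)[OF pq(2), of "p i"] by auto
  then show "p \<otimes>\<^bsub>Sym n\<^esub> q \<in> flip_group n m"
    using pq by (simp add: flip_group_def permutes_compose)
next
  fix p
  assume p: "p \<in> flip_group n m"
  note perm = flip_groupD(1)[OF p]
  have "inv' p i \<in> {i, opposite_point m i}" for i
    using flip_groupD(2)[OF p, of "inv' p i"] permutes_inverses[OF perm] opposite_point_invol
    by (metis insertCI)
  then show "inv\<^bsub>Sym n\<^esub> p \<in> flip_group n m"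
    using perm permutes_inv[OF perm] by (simp add: flip_group_def)
qed

lemma transpose_in_flip_group:
  assumes "i \<in> {1..m}" "2 * m \<le> n"
  shows "transpose i (i + m) \<in> flip_group n m"
proof -
  have "transpose i (i + m) permutes {1..n}"
    using assms by (intro permutes_swap_id) auto
  then show ?thesis
    using assms by (auto simp: flip_group_def transpose_def opposite_point_def)
qed

text \<open>Stated for any subgroup \<open>K\<close>, since it serves both for the generated
  subgroup and for \<open>flip_group\<close> itself.\<close>

lemma flips_in_subgroup:
  assumes "subgroup K (Sym n)" "\<And>i. i \<in> {1..m} \<Longrightarrow> transpose i (i + m) \<in> K"
    and S: "S \<subseteq> {1..m}"
  shows "flips m S \<in> K"
proof -
  have "finite S"
    using S finite_subset by blast
  then show ?thesis
    using S
  proof induction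
    case empty
    have "flips m {} = id"
      by (auto simp: flips_def)
    then show ?case
      using subgroup_Sym_closed(1)[OF assms(1)] by metis
  next
    case (insert i S)
    then have "flips m (insert i S) = flips m S \<circ> transpose i (i + m)"
      by (auto simp: fun_eq_iff flips_def transpose_def opposite_point_def)
    then show ?case
      using insert assms(2) subgroup_Sym_closed(3)[OF assms(1)] by (metis insert_subset)
  qed
qed

text \<open>As \<open>h\<close> commutes with \<open>opposite_point\<close>, its values on
  \<open>{1..m}\<close> determine those on the partners; all other points are fixed.\<close>

lemma flip_group_eq_flips:
  assumes "h \<in> flip_group n m"
  shows "h = flips m {i \<in> {1..m}. h i \<noteq> i}"
proof
  fix i
  show "h i = flips m {i \<in> {1..m}. h i \<noteq> i} i"
    using flip_groupD(2)[OF assms, of i] flip_groupD(3)[OF assms, of i]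
    by (cases "i \<in> {1..m}"; cases "i \<in> {m + 1..2 * m}")
      (auto simp: flips_def opposite_point_def split: if_splits)
qed

lemma generate_flips:
  assumes "2 * m \<le> n"
  shows "generate (Sym n) {transpose i (i + m) | i. i \<in> {1..m}} = flip_group n m"
proof
  let ?T = "{transpose i (i + m) | i. i \<in> {1..m}}"
  have T: "?T \<subseteq> flip_group n m"
    using transpose_in_flip_group[OF _ assms] by blast
  then show "generate (Sym n) ?T \<subseteq> flip_group n m"
    using group.generate_subgroup_incl[OF group_Sym _ subgroup_flip_group] by blast
  have "subgroup (generate (Sym n) ?T) (Sym n)"
    using T subgroup.subset[OF subgroup_flip_group]
    by (intro group.generate_is_subgroup[OF group_Sym]) blast
  then have "flips m S \<in> generate (Sym n) ?T" if "S \<subseteq> {1..m}" for S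
    using that by (intro flips_in_subgroup) (auto intro: generate.incl)
  then show "flip_group n m \<subseteq> generate (Sym n) ?T"
    using flip_group_eq_flips by (metis (no_types, lifting) mem_Collect_eq subsetI)
qed

lemma card_flip_group:
  assumes "2 * m \<le> n"
  shows "card (flip_group n m) = 2 ^ m"
proof -
  have "bij_betw (flips m) (Pow {1..m}) (flip_group n m)"
  proof (rule bij_betw_byWitness[where f' = "\<lambda>h. {i \<in> {1..m}. h i \<noteq> i}"])
    show "\<forall>S\<in>Pow {1..m}. {i \<in> {1..m}. flips m S i \<noteq> i} = S"
      by (auto simp: flips_def opposite_point_def split: if_splits)
    show "\<forall>h\<in>flip_group n m. flips m {i \<in> {1..m}. h i \<noteq> i} = h"
      using flip_group_eq_flips by metis
    show "flips m ` Pow {1..m} \<subseteq> flip_group n m"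
      using flips_in_subgroup[OF subgroup_flip_group] transpose_in_flip_group[OF _ assms] by blast
  qed auto
  then show ?thesis
    using bij_betw_same_card card_Pow[of "{1..m}"] by fastforce
qed

section \<open>The \<open>n\<close>-cycle and conjugation by it\<close>

lemma cycle_of_list_upt_apply:
  assumes "n > 0"
  shows "cycle_of_list [1..<n + 1] i = (if i \<in> {1..<n} then i + 1 else if i = n then 1 else i)"
proof (cases "i \<in> {1..n}")
  case True
  \<comment> \<open>The point \<open>i\<close> stands at position \<open>i - 1\<close>, as positions
    start at 0.\<close>
  then have "map (cycle_of_list [1..<n + 1]) [1..<n + 1] ! (i - 1) = rotate1 [1..<n + 1] ! (i - 1)"
    using cyclic_rotation[of "[1..<n + 1]" 1] by simp
  then show ?thesis
    using True assms by (auto simp: nth_rotate1 mod_Suc nth_upt simp del: upt_Suc)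
next
  case False
  then show ?thesis
    using id_outside_supp[of i "[1..<n + 1]"] assms by auto
qed

text \<open>The conjugate moves \<open>i\<close> exactly when \<open>h\<close> moves
  \<open>p i\<close>; only at such points must \<open>p\<close> respect partners.\<close>

lemma conj_in_flip_group:
  assumes h: "h \<in> flip_group n m" and p: "p permutes {1..n}"
    and "\<And>i. i \<in> {1..n} \<Longrightarrow> h (p i) \<noteq> p i \<Longrightarrow> opposite_point m (p i) = p (opposite_point m i)"
  shows "inv' p \<circ> h \<circ> p \<in> flip_group n m"
proof -
  have "inv' p (h (p i)) \<in> {i, opposite_point m i}" for i
  proof (cases "h (p i) = p i")
    case True
    then show ?thesis
      using permutes_inverses[OF p] by simp
  next
    case False
    then have "p i \<in> {1..n}"
      using permutes_not_in[OF flip_groupD(1)[OF h]] by blast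
    then have "i \<in> {1..n}"
      using permutes_in_image[OF p] by blast
    then show ?thesis
      using assms(3) False flip_groupD(2)[OF h, of "p i"] permutes_inverses[OF p] by auto
  qed
  moreover have "inv' p \<circ> h \<circ> p permutes {1..n}"
    using p flip_groupD(1)[OF h] by (intro permutes_compose permutes_inv)
  ultimately show ?thesis
    by (simp add: flip_group_def)
qed

locale rotation_flips =
  fixes n m :: nat and g :: "nat \<Rightarrow> nat"
  assumes m: "m \<ge> 2" and n: "n = 2 * m + 1"
    and g: "g = cycle_of_list [1..<n + 1]"
begin

lemma g_apply: "g i = (if i \<in> {1..<n} then i + 1 else if i = n then 1 else i)"
  unfolding g using cycle_of_list_upt_apply[of n i] n by simp

lemma g_permutes: "g permutes {1..n}"
proof -
  have "set [1..<n + 1] = {1..n}"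
    by auto
  then show ?thesis
    using cycle_permutes[of "[1..<n + 1]"] unfolding g by metis
qed

lemma inv_g_apply: "inv' g i = (if i \<in> {2..n} then i - 1 else if i = 1 then n else i)"
  unfolding permutes_inv_eq[OF g_permutes] using n m by (auto simp: g_apply)

text \<open>The point \<open>n = 2 * m + 1\<close> lies beyond all pairs. Moving it is the test for
  not belonging to the group.\<close>

lemma flip_group_fixes_n:
  assumes "h \<in> flip_group n m"
  shows "h n = n"
  using flip_groupD(2)[OF assms, of n] n by (simp add: opposite_point_def)

text \<open>The point \<open>n\<close> goes to 1, then to 1 or \<open>m + 1\<close>, then to 2 or
  \<open>m + 2\<close>; neither is \<open>n\<close>, because \<open>m \<ge> 2\<close>.\<close>

lemma g_flip_g_notin:
  assumes "h \<in> flip_group n m"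
  shows "g \<circ> (h \<circ> g) \<notin> flip_group n m"
proof
  assume "g \<circ> (h \<circ> g) \<in> flip_group n m"
  then have "g (h 1) = n"
    using flip_group_fixes_n[of "g \<circ> (h \<circ> g)"] n by (simp add: g_apply)
  moreover have "h 1 = 1 \<or> h 1 = m + 1"
    using flip_groupD(2)[OF assms, of 1] m by (simp add: opposite_point_def)
  ultimately show False
    using m n by (auto simp: g_apply)
qed

text \<open>On \<open>{1..n}\<close>, \<open>g\<close> respects partners except at \<open>m\<close>,
  \<open>2 * m\<close> and \<open>n\<close>. Their images \<open>m + 1\<close>, \<open>n\<close> and
  1 are fixed by \<open>h\<close>.\<close>

lemma conj_g_flip:
  assumes h: "h \<in> flip_group n m" and "h 1 = 1"
  shows "inv' g \<circ> h \<circ> g \<in> flip_group n m"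
proof (rule conj_in_flip_group[OF h g_permutes])
  fix i
  assume i: "i \<in> {1..n}" "h (g i) \<noteq> g i"
  have "h (m + 1) = m + 1"
    using flip_groupD(3)[OF h, of 1] assms(2) m by (simp add: opposite_point_def)
  then have "i \<noteq> m" "i \<noteq> n" "i \<noteq> 2 * m"
    using i assms(2) flip_group_fixes_n[OF h] n m by (auto simp: g_apply)
  then show "opposite_point m (g i) = g (opposite_point m i)"
    using i n m by (auto simp: g_apply opposite_point_def)
qed

text \<open>Here the exceptions are 1, \<open>m + 1\<close> and \<open>n\<close>, which the inverse
  of \<open>g\<close> sends to the fixed points \<open>n\<close>, \<open>m\<close> and
  \<open>2 * m\<close> of \<open>h\<close>.\<close>

lemma conj_inv_g_flip:
  assumes h: "h \<in> flip_group n m" and "h m = m"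
  shows "g \<circ> h \<circ> inv' g \<in> flip_group n m"
proof -
  have "inv' (inv' g) \<circ> h \<circ> inv' g \<in> flip_group n m"
  proof (rule conj_in_flip_group[OF h permutes_inv[OF g_permutes]])
    fix i
    assume i: "i \<in> {1..n}" "h (inv' g i) \<noteq> inv' g i"
    have "h (2 * m) = 2 * m"
      using flip_groupD(3)[OF h, of m] assms(2) m by (simp add: opposite_point_def mult_2)
    then have "i \<noteq> 1" "i \<noteq> m + 1" "i \<noteq> n"
      using i assms(2) flip_group_fixes_n[OF h] n m by (auto simp: inv_g_apply)
    then show "opposite_point m (inv' g i) = inv' g (opposite_point m i)"
      using i n m by (auto simp: inv_g_apply opposite_point_def)
  qed
  then show ?thesis
    using inv_inv_eq[OF permutes_bij[OF g_permutes]] by simp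
qed

lemma transpose_1_in: "transpose 1 (m + 1) \<in> flip_group n m"
  using transpose_in_flip_group[of 1 m n] m n by (simp add: add.commute)

lemma transpose_m_in: "transpose m (2 * m) \<in> flip_group n m"
  using transpose_in_flip_group[of m m n] m n by (simp add: mult_2)

text \<open>The conjugate sends \<open>n\<close> to \<open>m\<close>.\<close>

lemma conj_g_transpose_notin: "inv' g \<circ> transpose 1 (m + 1) \<circ> g \<notin> flip_group n m"
  using flip_group_fixes_n[of "inv' g \<circ> transpose 1 (m + 1) \<circ> g"] m n
  by (auto simp: g_apply inv_g_apply)

text \<open>The conjugate sends \<open>n\<close> to \<open>m + 1\<close>.\<close>

lemma conj_inv_g_transpose_notin: "g \<circ> transpose m (2 * m) \<circ> inv' g \<notin> flip_group n m"
  using flip_group_fixes_n[of "g \<circ> transpose m (2 * m) \<circ> inv' g"] m n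
  by (auto simp: g_apply inv_g_apply)

text \<open>If \<open>h\<close> moves 1, it sends 1 to \<open>m + 1\<close>, and composing with the
  transposition of these two points restores 1, so that \<open>conj_g_flip\<close> applies.\<close>

lemma conj_g_index:
  assumes "h \<in> flip_group n m"
  shows "inv' g \<circ> h \<circ> g \<in> flip_group n m \<or>
    inv' g \<circ> (transpose 1 (m + 1) \<circ> h) \<circ> g \<in> flip_group n m"
proof (cases "h 1 = 1")
  case True
  then show ?thesis
    using conj_g_flip assms by simp
next
  case False
  then have "h 1 = m + 1"
    using flip_groupD(2)[OF assms, of 1] m by (simp add: opposite_point_def)
  moreover have "transpose 1 (m + 1) \<circ> h \<in> flip_group n m"
    using subgroup_Sym_closed(3)[OF subgroup_flip_group] transpose_1_in assms by blast
  ultimately show ?thesis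
    using conj_g_flip[of "transpose 1 (m + 1) \<circ> h"] by simp
qed

lemma conj_inv_g_index:
  assumes "h \<in> flip_group n m"
  shows "g \<circ> h \<circ> inv' g \<in> flip_group n m \<or>
    g \<circ> (transpose m (2 * m) \<circ> h) \<circ> inv' g \<in> flip_group n m"
proof (cases "h m = m")
  case True
  then show ?thesis
    using conj_inv_g_flip assms by simp
next
  case False
  then have "h m = 2 * m"
    using flip_groupD(2)[OF assms, of m] m by (simp add: opposite_point_def)
  moreover have "transpose m (2 * m) \<circ> h \<in> flip_group n m"
    using subgroup_Sym_closed(3)[OF subgroup_flip_group] transpose_m_in assms by blast
  ultimately show ?thesis
    using conj_inv_g_flip[of "transpose m (2 * m) \<circ> h"] by simp
qed

lemma generate_g_flips: "generate (Sym n) (insert g (flip_group n m)) = carrier (Sym n)"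
proof (rule subgroup_Sym_eq_carrier)
  let ?K = "generate (Sym n) (insert g (flip_group n m))"
  show K: "subgroup ?K (Sym n)"
    using g_permutes subgroup.subset[OF subgroup_flip_group]
    by (intro group.generate_is_subgroup[OF group_Sym]) auto
  note sub = subgroup_Sym_closed[OF K]
  have gK: "g \<in> ?K" and HK: "flip_group n m \<subseteq> ?K"
    by (auto intro: generate.incl)
  have shift: "transpose (g i) (g j) \<in> ?K" if "transpose i j \<in> ?K" for i j
    using sub(3)[OF sub(3)[OF gK that] sub(4)[OF gK]]
    unfolding conj_transpose[OF permutes_bij[OF g_permutes]] .
  have "transpose (m + 1) n \<in> ?K"
    using shift[of m "2 * m"] transpose_m_in HK m n by (auto simp: g_apply)
  moreover have "transpose 1 (m + 1) \<in> ?K"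
    using transpose_1_in HK by blast
  ultimately have "transpose (m + 1) n \<circ> transpose 1 (m + 1) \<circ> transpose (m + 1) n \<in> ?K"
    using sub(3) by blast
  moreover have "transpose (m + 1) n \<circ> transpose 1 (m + 1) \<circ> transpose (m + 1) n = transpose 1 n"
    using m n by (auto simp: fun_eq_iff transpose_def)
  \<comment> \<open>The order \<open>n\<close>, 1 is the one that \<open>g\<close> shifts to 1,
    2.\<close>
  ultimately have "transpose n 1 \<in> ?K"
    by (simp add: transpose_commute)
  then have base: "transpose 1 (Suc 1) \<in> ?K"
    using shift[of n 1] n m by (simp add: g_apply)
  fix i
  assume "1 \<le> i" "i < n"
  then show "transpose i (Suc i) \<in> ?K"
  proof (induction i rule: dec_induct)
    case base
    then show ?case
      using \<open>transpose 1 (Suc 1) \<in> ?K\<close> by simp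
  next
    case (step i)
    then have "g i = Suc i" "g (Suc i) = Suc (Suc i)"
      by (simp_all add: g_apply)
    then show ?case
      using shift[of i "Suc i"] step by (metis Suc_lessD)
  qed
qed

text \<open>If \<open>p\<close> moved \<open>i\<close>, its conjugate by
  \<open>transpose i n\<close> would move \<open>n\<close>.\<close>

lemma flip_group_core:
  assumes "p permutes {1..n}"
    and core: "\<And>q. q permutes {1..n} \<Longrightarrow> inv' q \<circ> (p \<circ> q) \<in> flip_group n m"
  shows "p = id"
proof (rule ccontr)
  assume "p \<noteq> id"
  then obtain i where i: "p i \<noteq> i"
    by (auto simp: fun_eq_iff)
  then have "i \<in> {1..n}"
    using permutes_not_in[OF assms(1)] by blast
  then have "transpose i n permutes {1..n}"
    using n by (intro permutes_swap_id) auto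
  then have "(inv' (transpose i n) \<circ> (p \<circ> transpose i n)) n = n"
    using core flip_group_fixes_n by blast
  then show False
    using i by (auto simp: transpose_eq_iff)
qed

end

section \<open>The coset graph of the symmetric group\<close>

theorem lemma5p4:
  fixes n m :: nat and G :: "(nat \<Rightarrow> nat) monoid" and H :: "(nat \<Rightarrow> nat) set"
    and g :: "nat \<Rightarrow> nat" and \<Gamma> :: "(nat \<Rightarrow> nat) set pair_pre_digraph"
  assumes "n \<ge> 5" and "odd n"
    and "G = Sym n"
    and "m = (n - 1) div 2"
    and "H = generate G {transpose i (i + m) | i. i \<in> {1..m}}"
    and "g = cycle_of_list [1..<n + 1]"
    and "\<Gamma> = coset_graph G H g"
  shows "basic_quasiprimitive_type \<Gamma> G (right_mult_action G H) \<and>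
    (\<forall>x \<in> pverts \<Gamma>. card (stabilizer G (right_mult_action G H) x) = 2 ^ ((n - 1) div 2))"
proof -
  interpret rotation_flips n m g
    using assms by unfold_locales (auto elim!: oddE)
  let ?S = "Sym n"
  let ?K = "flip_group n m"
  have H: "H = ?K"
    using assms(3,5) generate_flips[of m n] n by simp
  interpret oriented_coset_graph ?S ?K g
    using g_permutes g_flip_g_notin
    by (intro oriented_coset_graph.intro coset_space.intro oriented_coset_graph_axioms.intro
        group_Sym subgroup_flip_group) simp_all
  have inv_g: "inv\<^bsub>?S\<^esub> g = inv' g"
    using g_permutes by simp
  have inv_transpose: "inv\<^bsub>?S\<^esub> t = inv' t" if "t \<in> ?K" for t
    using flip_groupD(1)[OF that] by simp
  have degree: "out_degree (with_proj (coset_graph ?S ?K g)) C = 4" if "C \<in> rcosets\<^bsub>?S\<^esub> ?K" for C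
  \<comment> \<open>Read left to right, conjugation as in
    \<open>g \<otimes> h \<otimes> inv g\<close> is the function
    \<open>inv' g \<circ> h \<circ> g\<close>; hence \<open>transpose 1 (m + 1)\<close> is the
    witness on this side and \<open>transpose m (2 * m)\<close> on the other.\<close>
  proof (rule out_degree_coset_graph[OF that transpose_1_in _ _ transpose_m_in])
    show "g \<otimes>\<^bsub>?S\<^esub> transpose 1 (m + 1) \<otimes>\<^bsub>?S\<^esub> inv\<^bsub>?S\<^esub> g \<notin> ?K"
      unfolding inv_g using conj_g_transpose_notin by (simp add: comp_assoc)
    show "inv\<^bsub>?S\<^esub> g \<otimes>\<^bsub>?S\<^esub> transpose m (2 * m) \<otimes>\<^bsub>?S\<^esub> g \<notin> ?K"
      unfolding inv_g using conj_inv_g_transpose_notin by (simp add: comp_assoc)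
  next
    fix h
    assume h: "h \<in> ?K"
    show "g \<otimes>\<^bsub>?S\<^esub> h \<otimes>\<^bsub>?S\<^esub> inv\<^bsub>?S\<^esub> g \<in> ?K \<or>
        g \<otimes>\<^bsub>?S\<^esub> (h \<otimes>\<^bsub>?S\<^esub> inv\<^bsub>?S\<^esub> transpose 1 (m + 1)) \<otimes>\<^bsub>?S\<^esub> inv\<^bsub>?S\<^esub> g \<in> ?K"
      unfolding inv_g inv_transpose[OF transpose_1_in]
      using conj_g_index[OF h] by (simp add: comp_assoc)
    show "inv\<^bsub>?S\<^esub> g \<otimes>\<^bsub>?S\<^esub> h \<otimes>\<^bsub>?S\<^esub> g \<in> ?K \<or>
        inv\<^bsub>?S\<^esub> g \<otimes>\<^bsub>?S\<^esub> (h \<otimes>\<^bsub>?S\<^esub> inv\<^bsub>?S\<^esub> transpose m (2 * m)) \<otimes>\<^bsub>?S\<^esub> g \<in> ?K"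
      unfolding inv_g inv_transpose[OF transpose_m_in]
      using conj_inv_g_index[OF h] by (simp add: comp_assoc)
  qed
  have quasi: "transitive_right_action (?S\<lparr>carrier := N\<rparr>) (rcosets\<^bsub>?S\<^esub> ?K) (right_mult_action ?S ?K)"
    if "N \<lhd> ?S" "N \<noteq> {id}" for N
    using Sym_subgroup_mult_normal[OF that assms(1) subgroup_flip_group transpose_1_in] m n
    by (intro transitive_right_mult[OF that(1)]) auto
  have trans: "transitive_right_action ?S (rcosets\<^bsub>?S\<^esub> ?K) (right_mult_action ?S ?K)"
  proof -
    have "carrier ?S \<lhd> ?S"
      by (intro normal_invI subgroup_self) (simp del: Sym_simps)
    \<comment> \<open>If \<open>g\<close> were \<open>id\<close>, then
      \<open>g \<circ> (id \<circ> g)\<close> would lie in \<open>?K\<close>. With the group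
      nontrivial, its own transitivity is the case of \<open>quasi\<close> where \<open>N\<close> is
      the whole group.\<close>
    moreover have "carrier ?S \<noteq> {id}"
      using g_permutes g_flip_g_notin[of id] subgroup_Sym_closed(1)[OF subgroup_flip_group] by force
    ultimately have "transitive_right_action (?S\<lparr>carrier := carrier ?S\<rparr>) (rcosets\<^bsub>?S\<^esub> ?K)
        (right_mult_action ?S ?K)"
      by (rule quasi)
    then show ?thesis
      by (simp del: Sym_simps)
  qed
  have faithful: "faithful_right_action ?S (rcosets\<^bsub>?S\<^esub> ?K) (right_mult_action ?S ?K)"
  proof (rule faithful_right_mult)
    fix p
    assume p: "p \<in> carrier ?S"
      "\<And>q. q \<in> carrier ?S \<Longrightarrow> q \<otimes>\<^bsub>?S\<^esub> p \<otimes>\<^bsub>?S\<^esub> inv\<^bsub>?S\<^esub> q \<in> ?K"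
    have "inv' q \<circ> (p \<circ> q) \<in> ?K" if "q permutes {1..n}" for q
      using p(2)[of q] that by simp
    then show "p = \<one>\<^bsub>?S\<^esub>"
      using p(1) flip_group_core by simp
  qed
  have "finite (carrier ?S)"
    by (simp add: finite_permutations)
  then have "OG4 (coset_graph ?S ?K g) ?S (right_mult_action ?S ?K)"
    unfolding OG4_def pverts_coset_graph
    using pair_graph_coset_graph connected_coset_graph generate_g_flips degree group_Sym faithful
      graph_automorphism_right_mult trans edge_transitive_right_mult oriented_right_mult
    by metis
  then have "basic_quasiprimitive_type (coset_graph ?S ?K g) ?S (right_mult_action ?S ?K)"
    using quasi by (simp add: basic_quasiprimitive_type_def quasiprimitive_def)
  moreover have "card (stabilizer ?S (right_mult_action ?S ?K) C) = 2 ^ m"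
    if "C \<in> rcosets\<^bsub>?S\<^esub> ?K" for C
    using card_stabilizer_right_mult[OF that] card_flip_group[of m n] n by simp
  ultimately show ?thesis
    unfolding assms(7) assms(3) H assms(4)[symmetric] by simp
qed

end
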